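(* Let $\{\mathcal M_{\boldsymbol\omega}:\boldsymbol\omega\in\Omega\}$ be a configurable Markov Decision Process and let $\Pi_\Theta$, $\Theta=\mathbb R^d$, be an identifiable space of linear policies of the exponential family (see context). Let $I\subseteq\{1,\dots,d\}$ and $\overline I=\{1,\dots,d\}\setminus I$. For a vector $\mathbf v\in\mathbb R^d$ and a set $K\subseteq\{1,\dots,d\}$, denote by $\mathbf v|_K$ the vector obtained from $\mathbf v$ by setting to zero the components with index in $K$. Let $\boldsymbol\theta^*(\boldsymbol\omega_0)\in\Theta$ be the initial parameter, let $\alpha\ge0$, $\boldsymbol\omega\in\Omega$, and $$\boldsymbol\theta_I^*(\boldsymbol\omega)=\boldsymbol\theta^*(\boldsymbol\omega_0)+\alpha\,\nabla_{\boldsymbol\theta}J_{\mathcal M_{\boldsymbol\omega}}(\boldsymbol\theta^*(\boldsymbol\omega_0))\big|_I,\qquad \boldsymbol\theta^*(\boldsymbol\omega)=\boldsymbol\theta^*(\boldsymbol\omega_0)+\alpha\,\nabla_{\boldsymbol\theta}J_{\mathcal M_{\boldsymbol\omega}}(\boldsymbol\theta^*(\boldsymbol\omega_0)).$$ Then $$\ell(\boldsymbol\theta_I^*(\boldsymbol\omega))-\ell(\boldsymbol\theta^*(\boldsymbol\omega))\ \ge\ \frac{\lambda_{\min}\,\alpha^2}{2}\,\Big\|\nabla_{\boldsymbol\theta}J_{\mathcal M_{\boldsymbol\omega}}(\boldsymbol\theta^*(\boldsymbol\omega_0))\big|_{\overline I}\Big\|_2^2 .$$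
   Context: A configurable MDP is a family $\mathcal M_{\boldsymbol\omega}=(\mathcal S,\mathcal A,p_{\boldsymbol\omega},\mu_{\boldsymbol\omega},r,\gamma)$, $\boldsymbol\omega\in\Omega\subseteq\mathbb R^p$, of MDPs sharing state space, action space, reward $r$ and discount $\gamma$, with transition model $p_{\boldsymbol\omega}$ and initial state distribution $\mu_{\boldsymbol\omega}$ depending on $\boldsymbol\omega$. For a policy $\pi$, $d_{\boldsymbol\omega}^{\pi}(s)=(1-\gamma)\sum_{t\ge0}\gamma^t\Pr(s_t=s\mid\mathcal M_{\boldsymbol\omega},\pi)$ is the discounted state distribution, and the expected return is $J_{\mathcal M_{\boldsymbol\omega}}(\boldsymbol\theta)=\frac1{1-\gamma}\mathbb E_{s\sim d_{\boldsymbol\omega}^{\pi_{\boldsymbol\theta}},\,a\sim\pi_{\boldsymbol\theta}(\cdot|s)}[r(s,a)]$, assumed differentiable in $\boldsymbol\theta$. Exponential family: for a feature function $\boldsymbol\phi:\mathcal S\to\mathbb R^q$, every policy in $\Pi_\Theta$ has the form $\pi_{\boldsymbol\theta}(a|s)=h(a)\exp\{\boldsymbol\theta^T\mathbf t(s,a)-A(\boldsymbol\theta,s)\}$, $\boldsymbol\theta\in\Theta=\mathbb R^d$, with $h$ positive, $\mathbf t(s,a)\in\mathbb R^d$ the sufficient statistic (depending on $s$ only through $\boldsymbol\phi(s)$), and $A(\boldsymbol\theta,s)=\log\int_{\mathcal A}h(a)\exp\{\boldsymbol\theta^T\mathbf t(s,a)\}\,da$. Centered statistic: $\overline{\mathbf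 t}(s,a,\boldsymbol\theta)=\mathbf t(s,a)-\mathbb E_{\overline a\sim\pi_{\boldsymbol\theta}(\cdot|s)}[\mathbf t(s,\overline a)]$. Identifiability: for all $\boldsymbol\theta,\boldsymbol\theta'\in\Theta$, if $\pi_{\boldsymbol\theta}=\pi_{\boldsymbol\theta'}$ almost surely then $\boldsymbol\theta=\boldsymbol\theta'$. Here $\ell$ is the expected negative log-likelihood under the agent's policy $\pi_{\boldsymbol\theta^*(\boldsymbol\omega)}$ in $\mathcal M_{\boldsymbol\omega}$: $\ell(\boldsymbol\theta)=\mathbb E_{s\sim d,\,a\sim\pi_{\boldsymbol\theta^*(\boldsymbol\omega)}(\cdot|s)}[-\log\pi_{\boldsymbol\theta}(a|s)]$ with $d=d_{\boldsymbol\omega}^{\pi_{\boldsymbol\theta^*(\boldsymbol\omega)}}$. The Fisher information matrix is $\mathcal F(\boldsymbol\theta)=\mathbb E_{s\sim d,\,a\sim\pi_{\boldsymbol\theta}(\cdot|s)}[\overline{\mathbf t}(s,a,\boldsymbol\theta)\overline{\mathbf t}(s,a,\boldsymbol\theta)^T]$ and $\lambda_{\min}=\inf_{\boldsymbol\theta\in\Theta}\lambda_{\min}(\mathcal F(\boldsymbol\theta))$, assumed to be $>0$, where $\lambda_{\min}(\cdot)$ denotes the smallest eigenvalue. The expectations defining $\ell$ and $\mathcal F$ are assumed finite and $\ell$ twice differentiable under the expectation sign. *)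

theory Defs
  imports "HOL-Probability.Probability"
begin

definition gradient :: "('v::real_inner \<Rightarrow> real) \<Rightarrow> 'v \<Rightarrow> 'v" where
  "gradient f x = (THE D. GDERIV f x :> D)"

definition zero_on :: "'n set \<Rightarrow> real^'n \<Rightarrow> real^'n" where
  "zero_on K v = (\<chi> i. if i \<in> K then 0 else v $ i)"

definition outer_square :: "real^'n \<Rightarrow> real^'n^'n" where
  "outer_square v = (\<chi> i j. v $ i * v $ j)"

definition eigenvalues :: "real^'n^'n \<Rightarrow> real set" where
  "eigenvalues A = {c. \<exists>v. v \<noteq> 0 \<and> A *v v = c *\<^sub>R v}"

(* Meaningful for matrices with a real eigenvalue; only used for symmetric ones. *)
definition min_eigenvalue :: "real^'n^'n \<Rightarrow> real" where
  "min_eigenvalue A = Min (eigenvalues A)"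

(* The integrands are twice differentiable in the parameter, their gradients and Hessians are
   integrable, and the gradient and the Hessian of the integral are the integrals of the
   gradients and of the Hessians. *)
definition twice_differentiable_under_integral ::
    "'x measure \<Rightarrow> (real^'n \<Rightarrow> 'x \<Rightarrow> real) \<Rightarrow> bool" where
  "twice_differentiable_under_integral N f \<longleftrightarrow>
    (\<exists>(g :: real^'n \<Rightarrow> 'x \<Rightarrow> real^'n) (H :: real^'n \<Rightarrow> 'x \<Rightarrow> real^'n^'n).
      (\<forall>v. \<forall>x \<in> space N.
         GDERIV (\<lambda>w. f w x) v :> g v x \<and>
         ((\<lambda>w. g w x) has_derivative (\<lambda>h. H v x *v h)) (at v)) \<and>
      (\<forall>v. integrable N (g v) \<and> integrable N (H v)) \<and>
      (\<forall>v. GDERIV (\<lambda>w. \<integral>x. f w x \<partial>N) v :> (\<integral>x. g v x \<partial>N)) \<and>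
      (\<forall>v. ((\<lambda>w. \<integral>x. g w x \<partial>N) has_derivative (\<lambda>h. (\<integral>x. H v x \<partial>N) *v h)) (at v)))"

(* Only the sigma-algebra of states is used. The measure actions is the reference measure "da"
   with respect to which policies have densities, e.g. Lebesgue or counting measure. *)
record ('s, 'a, 'p) configurable_mdp =
  states :: "'s measure"
  actions :: "'a measure"
  configs :: "(real^'p) set"
  transition :: "real^'p \<Rightarrow> 's \<times> 'a \<Rightarrow> 's measure"
  initial :: "real^'p \<Rightarrow> 's measure"
  reward :: "'s \<times> 'a \<Rightarrow> real"
  discount :: real

definition is_configurable_mdp :: "('s, 'a, 'p::finite) configurable_mdp \<Rightarrow> bool" where
  "is_configurable_mdp M \<longleftrightarrow>
    sigma_finite_measure (actions M) \<and>
    emeasure (actions M) (space (actions M)) \<noteq> 0 \<and>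
    reward M \<in> borel_measurable (states M \<Otimes>\<^sub>M actions M) \<and>
    0 \<le> discount M \<and> discount M < 1 \<and>
    (\<forall>\<omega> \<in> configs M.
       initial M \<omega> \<in> space (prob_algebra (states M)) \<and>
       transition M \<omega> \<in> states M \<Otimes>\<^sub>M actions M \<rightarrow>\<^sub>M prob_algebra (states M))"

(* The sufficient statistic takes the feature vector of the state as its first argument. *)
record ('s, 'a, 'q, 'd) policy_family =
  feature :: "'s \<Rightarrow> real^'q"
  statistic :: "real^'q \<Rightarrow> 'a \<Rightarrow> real^'d"
  base :: "'a \<Rightarrow> real"

definition suff_stat :: "('s, 'a, 'q::finite, 'd::finite) policy_family \<Rightarrow> 's \<Rightarrow> 'a \<Rightarrow> real^'d" where
  "suff_stat P s a = statistic P (feature P s) a"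

definition log_partition ::
    "('s, 'a, 'p::finite) configurable_mdp \<Rightarrow> ('s, 'a, 'q::finite, 'd::finite) policy_family \<Rightarrow>
     real^'d \<Rightarrow> 's \<Rightarrow> real" where
  "log_partition M P \<theta> s = ln (\<integral>a. base P a * exp (\<theta> \<bullet> suff_stat P s a) \<partial>actions M)"

definition policy_density ::
    "('s, 'a, 'p::finite) configurable_mdp \<Rightarrow> ('s, 'a, 'q::finite, 'd::finite) policy_family \<Rightarrow>
     real^'d \<Rightarrow> 's \<Rightarrow> 'a \<Rightarrow> real" where
  "policy_density M P \<theta> s a = base P a * exp (\<theta> \<bullet> suff_stat P s a - log_partition M P \<theta> s)"

definition policy ::
    "('s, 'a, 'p::finite) configurable_mdp \<Rightarrow> ('s, 'a, 'q::finite, 'd::finite) policy_family \<Rightarrow>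
     real^'d \<Rightarrow> 's \<Rightarrow> 'a measure" where
  "policy M P \<theta> s = density (actions M) (\<lambda>a. ennreal (policy_density M P \<theta> s a))"

(* The parameter space is all of R^d, so the partition function is finite for every parameter. *)
definition is_linear_exponential_family ::
    "('s, 'a, 'p::finite) configurable_mdp \<Rightarrow> ('s, 'a, 'q::finite, 'd::finite) policy_family \<Rightarrow> bool"
  where
  "is_linear_exponential_family M P \<longleftrightarrow>
    base P \<in> borel_measurable (actions M) \<and>
    (\<forall>a \<in> space (actions M). 0 < base P a) \<and>
    (\<lambda>(s, a). suff_stat P s a) \<in> borel_measurable (states M \<Otimes>\<^sub>M actions M) \<and>
    (\<forall>\<theta>. \<forall>s \<in> space (states M).
       integrable (actions M) (\<lambda>a. base P a * exp (\<theta> \<bullet> suff_stat P s a)))"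

definition centered_stat ::
    "('s, 'a, 'p::finite) configurable_mdp \<Rightarrow> ('s, 'a, 'q::finite, 'd::finite) policy_family \<Rightarrow>
     's \<Rightarrow> 'a \<Rightarrow> real^'d \<Rightarrow> real^'d" where
  "centered_stat M P s a \<theta> = suff_stat P s a - (\<integral>b. suff_stat P s b \<partial>policy M P \<theta> s)"

(* Joint law of (s, a) with s distributed according to D and a according to the policy at s. *)
definition state_action_law ::
    "('s, 'a, 'p::finite) configurable_mdp \<Rightarrow> ('s, 'a, 'q::finite, 'd::finite) policy_family \<Rightarrow>
     's measure \<Rightarrow> real^'d \<Rightarrow> ('s \<times> 'a) measure" where
  "state_action_law M P D \<theta> =
    density (D \<Otimes>\<^sub>M actions M) (\<lambda>(s, a). ennreal (policy_density M P \<theta> s a))"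

primrec state_law ::
    "('s, 'a, 'p::finite) configurable_mdp \<Rightarrow> ('s, 'a, 'q::finite, 'd::finite) policy_family \<Rightarrow>
     real^'p \<Rightarrow> real^'d \<Rightarrow> nat \<Rightarrow> 's measure" where
  "state_law M P \<omega> \<theta> 0 = initial M \<omega>"
| "state_law M P \<omega> \<theta> (Suc t) =
    state_action_law M P (state_law M P \<omega> \<theta> t) \<theta> \<bind> transition M \<omega>"

definition discounted_state_dist ::
    "('s, 'a, 'p::finite) configurable_mdp \<Rightarrow> ('s, 'a, 'q::finite, 'd::finite) policy_family \<Rightarrow>
     real^'p \<Rightarrow> real^'d \<Rightarrow> 's measure" where
  "discounted_state_dist M P \<omega> \<theta> =
    measure_of (space (states M)) (sets (states M))
      (\<lambda>B. ennreal (1 - discount M) *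
        (\<Sum>t. ennreal (discount M ^ t) * emeasure (state_law M P \<omega> \<theta> t) B))"

definition expected_return ::
    "('s, 'a, 'p::finite) configurable_mdp \<Rightarrow> ('s, 'a, 'q::finite, 'd::finite) policy_family \<Rightarrow>
     real^'p \<Rightarrow> real^'d \<Rightarrow> real" where
  "expected_return M P \<omega> \<theta> = 1 / (1 - discount M) *
    (\<integral>x. reward M x \<partial>state_action_law M P (discounted_state_dist M P \<omega> \<theta>) \<theta>)"

definition differentiable_return ::
    "('s, 'a, 'p::finite) configurable_mdp \<Rightarrow> ('s, 'a, 'q::finite, 'd::finite) policy_family \<Rightarrow> bool"
  where
  "differentiable_return M P \<longleftrightarrow>
    (\<forall>\<omega> \<in> configs M. \<forall>\<theta>.
       integrable (state_action_law M P (discounted_state_dist M P \<omega> \<theta>) \<theta>) (reward M) \<and>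
       expected_return M P \<omega> differentiable (at \<theta>))"

(* "Almost surely" refers to the state-action pairs visited by any policy of the family in any
   environment of the process. Identifiability relative to the visits of one fixed policy in one
   fixed environment is a stronger property. *)
definition identifiable ::
    "('s, 'a, 'p::finite) configurable_mdp \<Rightarrow> ('s, 'a, 'q::finite, 'd::finite) policy_family \<Rightarrow> bool"
  where
  "identifiable M P \<longleftrightarrow>
    (\<forall>\<theta> \<theta>'.
      (\<forall>\<omega> \<in> configs M. \<forall>\<eta>.
         AE (s, a) in state_action_law M P (discounted_state_dist M P \<omega> \<eta>) \<eta>.
           policy_density M P \<theta> s a = policy_density M P \<theta>' s a)
      \<longrightarrow> \<theta> = \<theta>')"

definition neg_log_lik ::
    "('s, 'a, 'p::finite) configurable_mdp \<Rightarrow> ('s, 'a, 'q::finite, 'd::finite) policy_family \<Rightarrow>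
     real^'d \<Rightarrow> 's \<times> 'a \<Rightarrow> real" where
  "neg_log_lik M P \<theta> = (\<lambda>(s, a). - ln (policy_density M P \<theta> s a))"

(* The data come from the agent with parameter \<eta> acting in the environment \<omega>. *)
definition expected_neg_log_lik ::
    "('s, 'a, 'p::finite) configurable_mdp \<Rightarrow> ('s, 'a, 'q::finite, 'd::finite) policy_family \<Rightarrow>
     real^'p \<Rightarrow> real^'d \<Rightarrow> real^'d \<Rightarrow> real" where
  "expected_neg_log_lik M P \<omega> \<eta> \<theta> =
    (\<integral>x. neg_log_lik M P \<theta> x
       \<partial>state_action_law M P (discounted_state_dist M P \<omega> \<eta>) \<eta>)"

definition fisher_integrand ::
    "('s, 'a, 'p::finite) configurable_mdp \<Rightarrow> ('s, 'a, 'q::finite, 'd::finite) policy_family \<Rightarrow>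
     real^'d \<Rightarrow> 's \<times> 'a \<Rightarrow> real^'d^'d" where
  "fisher_integrand M P \<theta> = (\<lambda>(s, a). outer_square (centered_stat M P s a \<theta>))"

(* The states follow the fixed distribution D, while the actions follow the policy with
   parameter \<theta>. *)
definition fisher_information ::
    "('s, 'a, 'p::finite) configurable_mdp \<Rightarrow> ('s, 'a, 'q::finite, 'd::finite) policy_family \<Rightarrow>
     's measure \<Rightarrow> real^'d \<Rightarrow> real^'d^'d" where
  "fisher_information M P D \<theta> =
    (\<integral>x. fisher_integrand M P \<theta> x \<partial>state_action_law M P D \<theta>)"

definition lambda_min ::
    "('s, 'a, 'p::finite) configurable_mdp \<Rightarrow> ('s, 'a, 'q::finite, 'd::finite) policy_family \<Rightarrow>
     's measure \<Rightarrow> real" where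
  "lambda_min M P D = (INF \<theta>. min_eigenvalue (fisher_information M P D \<theta>))"

end

theory Submission
  imports Defs
begin

text \<open>Along the segment from \<open>\<theta>\<^sub>s\<close> to \<open>\<theta>\<^sub>I\<close>, with direction \<open>v\<close>, the increment of the log-partition function
  at a state is the cumulant generating function of \<open>v \<bullet> t\<close> under the policy. Its first two
  derivatives are the mean and the variance of \<open>v \<bullet> t\<close>. After averaging over the states, the expected
  negative log-likelihood therefore has derivative zero at \<open>\<theta>\<^sub>s\<close>, and its second derivative is the
  quadratic form of the Fisher information, which is at least \<open>lambda_min * (norm v)\<^sup>2\<close>. The bound
  is Taylor's formula of order two.\<close>

section \<open>Quadratic forms of integrated matrices\<close>

lemma linear_quadratic_form: "linear (\<lambda>A :: real^'n^'n. x \<bullet> (A *v y))"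
  by (auto intro!: linearI simp: matrix_vector_mult_add_rdistrib inner_add_right
      scaleR_matrix_vector_assoc[symmetric])

lemma inner_integral_matrix_vector:
  fixes f :: "'a \<Rightarrow> real^'n^'n"
  assumes "integrable N f"
  shows "x \<bullet> ((\<integral>a. f a \<partial>N) *v y) = (\<integral>a. x \<bullet> (f a *v y) \<partial>N)"
    and "integrable N (\<lambda>a. x \<bullet> (f a *v y))"
proof -
  have "bounded_linear (\<lambda>A :: real^'n^'n. x \<bullet> (A *v y))"
    using linear_quadratic_form linear_conv_bounded_linear by blast
  from integral_bounded_linear[OF this assms] integrable_bounded_linear[OF this assms]
  show "x \<bullet> ((\<integral>a. f a \<partial>N) *v y) = (\<integral>a. x \<bullet> (f a *v y) \<partial>N)"
    and "integrable N (\<lambda>a. x \<bullet> (f a *v y))" by simp_all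
qed

lemma outer_square_mult: "outer_square u *v y = (u \<bullet> y) *\<^sub>R u"
  by (simp add: vec_eq_iff outer_square_def matrix_vector_mult_def inner_vec_def
      sum_distrib_left sum_distrib_right mult_ac)

section \<open>The smallest eigenvalue of a symmetric matrix\<close>

context
  fixes A :: "real^'n^'n"
  assumes sym: "\<And>x y. x \<bullet> (A *v y) = y \<bullet> (A *v x)"
begin

text \<open>By symmetry, eigenvectors for distinct eigenvalues are orthogonal, hence independent,
  and independent sets in finite dimension are finite. This makes \<open>Min\<close> in
  \<open>min_eigenvalue\<close> meaningful.\<close>

lemma finite_eigenvalues: "finite (eigenvalues A)"
proof -
  define e where "e c = (SOME v. v \<noteq> 0 \<and> A *v v = c *\<^sub>R v)" for c
  have e: "e c \<noteq> 0" "A *v e c = c *\<^sub>R e c" if "c \<in> eigenvalues A" for c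
    using that someI_ex[of "\<lambda>v. v \<noteq> 0 \<and> A *v v = c *\<^sub>R v"]
    unfolding e_def eigenvalues_def by auto
  have orth: "e c \<bullet> e c' = 0"
    if "c \<in> eigenvalues A" "c' \<in> eigenvalues A" "c \<noteq> c'" for c c'
    using sym[of "e c" "e c'"] that e by (simp add: inner_commute)
  have "pairwise orthogonal (e ` eigenvalues A)"
    using orth unfolding pairwise_def orthogonal_def by blast
  moreover have "0 \<notin> e ` eigenvalues A" using e by force
  ultimately have "independent (e ` eigenvalues A)"
    by (rule pairwise_orthogonal_independent)
  then have "finite (e ` eigenvalues A)" by (rule independent_imp_finite)
  \<comment> \<open>An eigenvector chosen for two distinct eigenvalues would be orthogonal to
    itself.\<close>
  moreover have "inj_on e (eigenvalues A)"
    using orth e by (metis inj_onI inner_eq_zero_iff)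
  ultimately show ?thesis by (rule finite_imageD)
qed

text \<open>Compactness of the unit sphere gives a minimiser \<open>u\<close> of the quadratic form;
  the vanishing of the first variation makes it an eigenvector, with the minimum \<open>c\<close> as
  eigenvalue.\<close>

lemma rayleigh_minimum_is_eigenvalue:
  obtains c where "c \<in> eigenvalues A" "\<And>x. x \<bullet> (A *v x) \<ge> c * (norm x)\<^sup>2"
proof -
  have "compact (sphere (0 :: real^'n) 1)" by simp
  moreover have "sphere (0 :: real^'n) 1 \<noteq> {}" by simp
  moreover have "continuous_on (sphere 0 1) (\<lambda>x. x \<bullet> (A *v x))"
    by (intro continuous_intros matrix_vector_mult_linear_continuous_on)
  ultimately obtain u where u: "u \<in> sphere 0 1"
    and umin: "\<And>x. x \<in> sphere 0 1 \<Longrightarrow> u \<bullet> (A *v u) \<le> x \<bullet> (A *v x)"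
    using continuous_attains_inf[of "sphere 0 1" "\<lambda>x. x \<bullet> (A *v x)"] by blast
  define c where "c = u \<bullet> (A *v u)"
  have low: "x \<bullet> (A *v x) \<ge> c * (norm x)\<^sup>2" for x
  proof (cases "x = 0")
    case False
    have "c \<le> (x /\<^sub>R norm x) \<bullet> (A *v (x /\<^sub>R norm x))"
      unfolding c_def using False by (intro umin) simp
    also have "\<dots> = (x \<bullet> (A *v x)) / (norm x)\<^sup>2"
      by (simp add: matrix_vector_mult_scaleR power2_eq_square divide_simps)
    finally show ?thesis using False by (simp add: field_simps)
  qed simp
  \<comment> \<open>Unless this residual vanishes, it is a direction in which a small negative step
    from \<open>u\<close> violates the lower bound \<open>low\<close>.\<close>
  define w where "w = A *v u - c *\<^sub>R u"
  have "w = 0"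
  proof (rule ccontr)
    assume "w \<noteq> 0"
    define b where "b = w \<bullet> (A *v w) - c * (norm w)\<^sup>2"
    have uu: "u \<bullet> u = 1" using u by (simp add: norm_eq_1)
    have "w \<bullet> w = w \<bullet> (A *v u) - c * (w \<bullet> u)"
      by (simp add: w_def inner_diff_right)
    then have ww: "w \<bullet> (A *v u) = w \<bullet> w + c * (w \<bullet> u)" by simp
    \<comment> \<open>In the expansion of \<open>low\<close> at \<open>u + t *\<^sub>R w\<close> the
      constant terms cancel; by symmetry and \<open>ww\<close> the linear coefficient is
      \<open>2 * (w \<bullet> w)\<close>.\<close>
    have quad: "0 \<le> 2 * t * (w \<bullet> w) + t\<^sup>2 * b" for t
      using low[of "u + t *\<^sub>R w"] sym[of u w] ww uu
      unfolding power2_norm_eq_inner b_def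
      by (simp add: matrix_vector_right_distrib inner_commute inner_add_left inner_add_right
          matrix_vector_mult_scaleR algebra_simps power2_eq_square c_def[symmetric])
    have "b \<ge> 0" using low[of w] by (simp add: b_def)
    \<comment> \<open>Dividing by \<open>b + 1\<close> covers \<open>b = 0\<close> and keeps
      \<open>t * b\<close> above \<open>- (w \<bullet> w)\<close>, so the quadratic is negative at
      this negative \<open>t\<close>.\<close>
    define t where "t = - (w \<bullet> w) / (b + 1)"
    have wpos: "w \<bullet> w > 0" using \<open>w \<noteq> 0\<close> by simp
    have "t < 0" using wpos \<open>b \<ge> 0\<close> by (simp add: t_def)
    have "(w \<bullet> w) * (b / (b + 1)) \<le> (w \<bullet> w) * 1"
      using wpos \<open>b \<ge> 0\<close> by (intro mult_left_mono) auto
    then have "0 < 2 * (w \<bullet> w) - (w \<bullet> w) * (b / (b + 1))" using wpos by linarith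
    then have "0 < 2 * (w \<bullet> w) + t * b" by (simp add: t_def)
    with \<open>t < 0\<close> have "t * (2 * (w \<bullet> w) + t * b) < 0" by (rule mult_neg_pos)
    with quad[of t] show False by (simp add: algebra_simps power2_eq_square)
  qed
  then have "A *v u = c *\<^sub>R u" by (simp add: w_def)
  moreover have "u \<noteq> 0" using u by auto
  ultimately have "c \<in> eigenvalues A" unfolding eigenvalues_def by blast
  with low that show ?thesis by blast
qed

lemma min_eigenvalue_le_rayleigh: "min_eigenvalue A * (norm x)\<^sup>2 \<le> x \<bullet> (A *v x)"
proof -
  obtain c where c: "c \<in> eigenvalues A" "x \<bullet> (A *v x) \<ge> c * (norm x)\<^sup>2"
    using rayleigh_minimum_is_eigenvalue by metis
  have "min_eigenvalue A \<le> c"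
    unfolding min_eigenvalue_def using finite_eigenvalues c(1) by (rule Min_le)
  then have "min_eigenvalue A * (norm x)\<^sup>2 \<le> c * (norm x)\<^sup>2" by (intro mult_right_mono) auto
  with c(2) show ?thesis by simp
qed

text \<open>The minimum is attained, so the form can be tested on one of its eigenvectors. This will
  bound from below the set whose infimum is \<open>lambda_min\<close>.\<close>

lemma min_eigenvalue_nonneg:
  assumes "\<And>x. 0 \<le> x \<bullet> (A *v x)"
  shows "0 \<le> min_eigenvalue A"
proof -
  have "eigenvalues A \<noteq> {}" using rayleigh_minimum_is_eigenvalue by blast
  then have "min_eigenvalue A \<in> eigenvalues A"
    unfolding min_eigenvalue_def using finite_eigenvalues by (intro Min_in)
  then obtain v where v: "v \<noteq> 0" "A *v v = min_eigenvalue A *\<^sub>R v"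
    unfolding eigenvalues_def by blast
  then have "0 \<le> min_eigenvalue A * (v \<bullet> v)" using assms[of v] by simp
  moreover have "v \<bullet> v > 0" using v(1) by simp
  ultimately show ?thesis by (simp add: zero_le_mult_iff)
qed

end

section \<open>Exponential moments and their derivatives\<close>

text \<open>The power is absorbed by shifting the exponent: \<open>\<bar>X a\<bar> ^ k\<close> is at
  most \<open>fact k * exp \<bar>X a\<bar>\<close>, and the last factor moves \<open>x\<close> to
  \<open>x + 1\<close> or \<open>x - 1\<close>, depending on the sign of \<open>X a\<close>.\<close>

lemma integrable_power_mult_exp:
  fixes X :: "'a \<Rightarrow> real"
  assumes [measurable]: "X \<in> borel_measurable N"
    and exp_int: "\<And>x. integrable N (\<lambda>a. exp (x * X a))"
  shows "integrable N (\<lambda>a. X a ^ k * exp (x * X a))"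
proof (rule Bochner_Integration.integrable_bound)
  show "integrable N (\<lambda>a. fact k * (exp ((x + 1) * X a) + exp ((x - 1) * X a)))"
    by (intro integrable_mult_right Bochner_Integration.integrable_add exp_int)
  show "AE a in N. norm (X a ^ k * exp (x * X a))
      \<le> norm (fact k * (exp ((x + 1) * X a) + exp ((x - 1) * X a)))"
  proof (intro AE_I2)
    fix a
    \<comment> \<open>One term of the exponential series is at most the whole series.\<close>
    have "(\<Sum>n\<in>{k}. inverse (fact n) *\<^sub>R \<bar>X a\<bar> ^ n) \<le> exp \<bar>X a\<bar>"
      unfolding exp_def by (intro sum_le_suminf summable_exp_generic) auto
    then have "\<bar>X a\<bar> ^ k \<le> fact k * exp \<bar>X a\<bar>" by (simp add: field_simps)
    then have "norm (X a ^ k * exp (x * X a)) \<le> fact k * exp \<bar>X a\<bar> * exp (x * X a)"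
      by (simp add: abs_mult power_abs mult_right_mono)
    also have "\<dots> \<le> fact k * (exp ((x + 1) * X a) + exp ((x - 1) * X a))"
      by (cases "X a \<ge> 0") (auto simp: mult.assoc exp_add[symmetric] algebra_simps)
    finally show "norm (X a ^ k * exp (x * X a))
      \<le> norm (fact k * (exp ((x + 1) * X a) + exp ((x - 1) * X a)))" by simp
  qed
qed simp

text \<open>Dominated convergence for the difference quotients along an arbitrary null sequence of
  nonzero increments; the mean value theorem supplies the dominating function.\<close>

lemma DERIV_integral_power_mult_exp:
  fixes X :: "'a \<Rightarrow> real"
  assumes [measurable]: "X \<in> borel_measurable N"
    and exp_int: "\<And>x. integrable N (\<lambda>a. exp (x * X a))"
  shows "((\<lambda>x. \<integral>a. X a ^ k * exp (x * X a) \<partial>N) has_real_derivative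
    (\<integral>a. X a ^ Suc k * exp (x * X a) \<partial>N)) (at x)"
  unfolding DERIV_def tendsto_at_iff_sequentially
proof (intro allI impI)
  note int = integrable_power_mult_exp[OF assms]
  fix h :: "nat \<Rightarrow> real"
  assume "\<forall>i. h i \<in> UNIV - {0}" and h0: "h \<longlonglongrightarrow> 0"
  then have h: "h i \<noteq> 0" for i by simp
  define q where "q n a = (X a ^ k * exp ((x + h n) * X a) - X a ^ k * exp (x * X a)) / h n" for n a
  \<comment> \<open>The dominating function works only for increments below 1, hence the shift by
    \<open>n0\<close>, undone at the end.\<close>
  obtain n0 where n0: "\<And>n. n \<ge> n0 \<Longrightarrow> \<bar>h n\<bar> < 1"
    using LIMSEQ_D[OF h0, of 1] by auto
  have "(\<lambda>n. \<integral>a. q (n + n0) a \<partial>N) \<longlonglongrightarrow> (\<integral>a. X a ^ Suc k * exp (x * X a) \<partial>N)"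
  proof (rule integral_dominated_convergence)
    show "integrable N (\<lambda>a. \<bar>X a ^ Suc k * exp ((x + 1) * X a)\<bar> + \<bar>X a ^ Suc k * exp ((x - 1) * X a)\<bar>)"
      by (intro Bochner_Integration.integrable_add integrable_abs int)
    show "AE a in N. (\<lambda>n. q (n + n0) a) \<longlonglongrightarrow> X a ^ Suc k * exp (x * X a)"
    proof (intro AE_I2)
      fix a
      have "((\<lambda>x. X a ^ k * exp (x * X a)) has_real_derivative X a ^ Suc k * exp (x * X a)) (at x)"
        by (auto intro!: derivative_eq_intros)
      then have "(\<lambda>n. q n a) \<longlonglongrightarrow> X a ^ Suc k * exp (x * X a)"
        unfolding DERIV_def tendsto_at_iff_sequentially q_def
        using h h0 by (auto simp: o_def)
      then show "(\<lambda>n. q (n + n0) a) \<longlonglongrightarrow> X a ^ Suc k * exp (x * X a)"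
        by (rule LIMSEQ_ignore_initial_segment)
    qed
    show "AE a in N. norm (q (n + n0) a)
      \<le> \<bar>X a ^ Suc k * exp ((x + 1) * X a)\<bar> + \<bar>X a ^ Suc k * exp ((x - 1) * X a)\<bar>" for n
    proof (intro AE_I2)
      fix a
      define y where "y = X a"
      define e where "e = h (n + n0)"
      have e: "e \<noteq> 0" "\<bar>e\<bar> < 1" using h n0 by (auto simp: e_def)
      have deriv: "((\<lambda>t. exp (t * y)) has_real_derivative y * exp (t * y)) (at t)" for t
        by (auto intro!: derivative_eq_intros)
      \<comment> \<open>The mean value point is written as \<open>x + z\<close>; the case split
        orders the endpoints of the interval.\<close>
      obtain z where z: "\<bar>z\<bar> \<le> 1" and eq: "exp ((x + e) * y) - exp (x * y) = e * (y * exp ((x + z) * y))"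
      proof (cases "e > 0")
        case True
        obtain z where "x < z" "z < x + e" "exp ((x + e) * y) - exp (x * y) = e * (y * exp (z * y))"
          using MVT2[of x "x + e", OF _ deriv] True by auto
        then show ?thesis using that[of "z - x"] e by auto
      next
        case False
        obtain z where "x + e < z" "z < x" "exp (x * y) - exp ((x + e) * y) = - e * (y * exp (z * y))"
          using MVT2[of "x + e" x, OF _ deriv] False e by auto
        then show ?thesis using that[of "z - x"] e by auto
      qed
      have "q (n + n0) a = y ^ k * (exp ((x + e) * y) - exp (x * y)) / e"
        by (simp add: q_def y_def e_def algebra_simps)
      also have "\<dots> = y ^ Suc k * exp ((x + z) * y)" using e by (simp add: eq)
      finally have "norm (q (n + n0) a) = \<bar>y\<bar> ^ Suc k * exp ((x + z) * y)"
        by (simp add: abs_mult power_abs)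
      \<comment> \<open>Adding both extreme exponentials serves either sign of \<open>y\<close> and
        removes the dependence on \<open>n\<close>.\<close>
      also have "exp ((x + z) * y) \<le> exp ((x + 1) * y) + exp ((x - 1) * y)"
      proof (cases "y \<ge> 0")
        case True
        then have "(x + z) * y \<le> (x + 1) * y" using z by (intro mult_right_mono) auto
        then show ?thesis by (smt (verit) exp_le_cancel_iff exp_gt_zero)
      next
        case False
        then have "(x + z) * y \<le> (x - 1) * y" using z by (intro mult_right_mono_neg) auto
        then show ?thesis by (smt (verit) exp_le_cancel_iff exp_gt_zero)
      qed
      finally show "norm (q (n + n0) a)
        \<le> \<bar>X a ^ Suc k * exp ((x + 1) * X a)\<bar> + \<bar>X a ^ Suc k * exp ((x - 1) * X a)\<bar>"
        by (simp add: y_def[symmetric] abs_mult power_abs distrib_left mult_left_mono)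
    qed
  qed (auto simp: q_def)
  then have "(\<lambda>n. \<integral>a. q n a \<partial>N) \<longlonglongrightarrow> (\<integral>a. X a ^ Suc k * exp (x * X a) \<partial>N)"
    by (rule LIMSEQ_offset)
  moreover have "(\<integral>a. q n a \<partial>N) =
    ((\<integral>a. X a ^ k * exp ((x + h n) * X a) \<partial>N) - (\<integral>a. X a ^ k * exp (x * X a) \<partial>N)) / h n" for n
    unfolding q_def by (simp add: Bochner_Integration.integral_diff[OF int int])
  ultimately show "((\<lambda>h. ((\<integral>a. X a ^ k * exp ((x + h) * X a) \<partial>N) -
    (\<integral>a. X a ^ k * exp (x * X a) \<partial>N)) / h) \<circ> h) \<longlonglongrightarrow> (\<integral>a. X a ^ Suc k * exp (x * X a) \<partial>N)"
    by (simp add: o_def)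
qed

text \<open>With integral zero the function would vanish almost everywhere, and the whole space
  would be null. This keeps the arguments of \<open>ln\<close> positive in what follows.\<close>

lemma integral_pos:
  fixes f :: "'a \<Rightarrow> real"
  assumes "integrable N f" and pos: "\<And>a. a \<in> space N \<Longrightarrow> 0 < f a"
    and "emeasure N (space N) \<noteq> 0"
  shows "0 < (\<integral>a. f a \<partial>N)"
proof -
  have nonneg: "AE a in N. 0 \<le> f a" using pos by (intro AE_I2) (simp add: less_imp_le)
  have "(\<integral>a. f a \<partial>N) \<noteq> 0"
  proof
    assume "(\<integral>a. f a \<partial>N) = 0"
    then have "AE a in N. f a = 0"
      using integral_nonneg_eq_0_iff_AE[OF assms(1) nonneg] by simp
    then have "AE a in N. False" using AE_space by eventually_elim (use pos in force)
    with assms(3) show False by (simp add: AE_iff_measurable[OF sets.top])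
  qed
  with integral_nonneg_AE[OF nonneg] show ?thesis by linarith
qed

text \<open>\<open>K\<close> is the quotient of the first exponential moment by the zeroth. At 0 the
  zeroth moment is 1, so the quotient rule leaves the second moment minus the square of the first,
  which is the variance.\<close>

lemma cumulant_generating_function_derivs:
  fixes X :: "'a \<Rightarrow> real"
  assumes "prob_space N" and [measurable]: "X \<in> borel_measurable N"
    and exp_int: "\<And>x. integrable N (\<lambda>a. exp (x * X a))"
  obtains K where
    "\<And>x. ((\<lambda>x. ln (\<integral>a. exp (x * X a) \<partial>N)) has_real_derivative K x) (at x)"
    "K 0 = (\<integral>a. X a \<partial>N)"
    "(K has_real_derivative (\<integral>a. (X a - (\<integral>b. X b \<partial>N))\<^sup>2 \<partial>N)) (at 0)"
proof -
  interpret prob_space N by fact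
  define Z where "Z k x = (\<integral>a. X a ^ k * exp (x * X a) \<partial>N)" for k x
  have Z: "(Z k has_real_derivative Z (Suc k) x) (at x)" for k x
    using DERIV_integral_power_mult_exp[OF assms(2,3)] unfolding Z_def by simp
  have int: "integrable N (\<lambda>a. X a ^ k)" for k
    using integrable_power_mult_exp[OF assms(2,3), of k 0] by simp
  have Zpos: "Z 0 x > 0" for x
    unfolding Z_def by (intro integral_pos) (simp_all add: exp_int emeasure_space_1)
  show ?thesis
  proof
    show "((\<lambda>x. ln (\<integral>a. exp (x * X a) \<partial>N)) has_real_derivative Z 1 x / Z 0 x) (at x)" for x
      using DERIV_chain2[OF DERIV_ln_divide[OF Zpos] Z[of 0 x]] by (simp add: Z_def)
    show "Z 1 0 / Z 0 0 = (\<integral>a. X a \<partial>N)" by (simp add: Z_def prob_space)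
    have "variance X = Z 2 0 - (Z 1 0)\<^sup>2"
      using variance_eq[OF int[of 1, simplified] int[of 2]] by (simp add: Z_def)
    moreover have "Z 0 0 = 1" by (simp add: Z_def prob_space)
    ultimately show "((\<lambda>x. Z 1 x / Z 0 x) has_real_derivative
      (\<integral>a. (X a - (\<integral>b. X b \<partial>N))\<^sup>2 \<partial>N)) (at 0)"
      using DERIV_divide[OF Z[of 1 0] Z[of 0 0]]
      by (simp add: power2_eq_square numeral_2_eq_2)
  qed
qed

section \<open>Exponential-family policies and the moments of their statistic\<close>

context
  fixes M :: "('s, 'a, 'p::finite) configurable_mdp"
    and P :: "('s, 'a, 'q::finite, 'd::finite) policy_family"
  assumes mdp: "is_configurable_mdp M"
    and family: "is_linear_exponential_family M P"
begin

interpretation actions: sigma_finite_measure "actions M"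
  using mdp unfolding is_configurable_mdp_def by simp

lemma base_measurable [measurable]: "base P \<in> borel_measurable (actions M)"
  and base_pos: "a \<in> space (actions M) \<Longrightarrow> 0 < base P a"
  and stat_measurable [measurable]:
    "(\<lambda>(s, a). suff_stat P s a) \<in> borel_measurable (states M \<Otimes>\<^sub>M actions M)"
  and integrable_partition: "s \<in> space (states M) \<Longrightarrow>
    integrable (actions M) (\<lambda>a. base P a * exp (\<theta> \<bullet> suff_stat P s a))"
  using family unfolding is_linear_exponential_family_def by auto

lemma stat_measurable_section [measurable]:
  "s \<in> space (states M) \<Longrightarrow> suff_stat P s \<in> borel_measurable (actions M)"
  using measurable_compose[OF measurable_Pair1' stat_measurable] by simp

lemma log_partition_measurable [measurable]:
  "log_partition M P \<theta> \<in> borel_measurable (states M)"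
  unfolding log_partition_def by measurable

lemma policy_density_measurable [measurable]:
  "(\<lambda>(s, a). policy_density M P \<theta> s a) \<in> borel_measurable (states M \<Otimes>\<^sub>M actions M)"
  unfolding policy_density_def by measurable

lemma policy_density_measurable_section [measurable]:
  "s \<in> space (states M) \<Longrightarrow> policy_density M P \<theta> s \<in> borel_measurable (actions M)"
  using measurable_compose[OF measurable_Pair1' policy_density_measurable] by simp

lemma policy_density_nonneg: "a \<in> space (actions M) \<Longrightarrow> 0 \<le> policy_density M P \<theta> s a"
  unfolding policy_density_def using base_pos[of a] by simp

lemma exp_log_partition:
  assumes "s \<in> space (states M)"
  shows "exp (log_partition M P \<theta> s) = (\<integral>a. base P a * exp (\<theta> \<bullet> suff_stat P s a) \<partial>actions M)"
  unfolding log_partition_def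
  using mdp assms by (intro exp_ln integral_pos integrable_partition)
    (auto simp: is_configurable_mdp_def base_pos)

text \<open>Exponential tilting stays in the family: up to normalisation, the parameter moves from
  \<open>\<theta>\<close> to \<open>\<theta> + v\<close>.\<close>

lemma policy_density_add_mult_exp:
  "policy_density M P \<theta> s a * exp (v \<bullet> suff_stat P s a) =
    base P a * exp ((\<theta> + v) \<bullet> suff_stat P s a) / exp (log_partition M P \<theta> s)"
  unfolding policy_density_def by (simp add: inner_add_left exp_diff exp_add)

text \<open>By tilting, the moment generating function of the statistic is a quotient of two
  partition functions; it is finite for every \<open>v\<close> because all parameters are
  admissible.\<close>

lemma
  assumes "s \<in> space (states M)"
  shows integrable_policy_exp: "integrable (policy M P \<theta> s) (\<lambda>a. exp (v \<bullet> suff_stat P s a))"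
    and integral_policy_exp: "(\<integral>a. exp (v \<bullet> suff_stat P s a) \<partial>policy M P \<theta> s) =
      exp (log_partition M P (\<theta> + v) s - log_partition M P \<theta> s)"
proof -
  note [measurable] = stat_measurable_section[OF assms] policy_density_measurable_section[OF assms]
  have nonneg: "AE a in actions M. 0 \<le> policy_density M P \<theta> s a"
    by (intro AE_I2 policy_density_nonneg)
  show "integrable (policy M P \<theta> s) (\<lambda>a. exp (v \<bullet> suff_stat P s a))"
    unfolding policy_def using integrable_partition[OF assms]
    by (subst integrable_density[OF _ _ nonneg]) (auto simp: policy_density_add_mult_exp)
  show "(\<integral>a. exp (v \<bullet> suff_stat P s a) \<partial>policy M P \<theta> s) =
      exp (log_partition M P (\<theta> + v) s - log_partition M P \<theta> s)"
    unfolding policy_def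
    by (subst integral_density[OF _ _ nonneg])
      (auto simp: policy_density_add_mult_exp exp_diff exp_log_partition[OF assms])
qed

lemma sets_policy [measurable_cong]: "sets (policy M P \<theta> s) = sets (actions M)"
  unfolding policy_def by simp

text \<open>This is the moment generating function at \<open>v = 0\<close>. Its integrability gives
  finiteness first, so that \<open>measure\<close> and \<open>emeasure\<close> agree.\<close>

lemma prob_space_policy:
  assumes "s \<in> space (states M)"
  shows "prob_space (policy M P \<theta> s)"
proof
  note [measurable] = policy_density_measurable_section[OF assms]
  interpret finite_measure "policy M P \<theta> s"
    using integrable_policy_exp[OF assms, where v = 0 and \<theta> = \<theta>]
    by (intro finite_measureI) (auto simp: integrable_iff_bounded)
  have "measure (policy M P \<theta> s) (space (policy M P \<theta> s)) = 1"
    using integral_policy_exp[OF assms, where v = 0 and \<theta> = \<theta>] by simp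
  then show "emeasure (policy M P \<theta> s) (space (policy M P \<theta> s)) = 1"
    by (simp add: emeasure_eq_measure)
qed

text \<open>Exponential moments along the whole line through \<open>v\<close> give the first
  moment.\<close>

lemma integrable_policy_inner_stat:
  assumes "s \<in> space (states M)"
  shows "integrable (policy M P \<theta> s) (\<lambda>a. v \<bullet> suff_stat P s a)"
proof -
  note [measurable] = stat_measurable_section[OF assms]
  have meas: "(\<lambda>a. v \<bullet> suff_stat P s a) \<in> borel_measurable (policy M P \<theta> s)" by measurable
  have "integrable (policy M P \<theta> s) (\<lambda>a. exp (x * (v \<bullet> suff_stat P s a)))" for x
    using integrable_policy_exp[OF assms, where v = "x *\<^sub>R v" and \<theta> = \<theta>] by simp
  from integrable_power_mult_exp[OF meas this, of 1 0] show ?thesis by simp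
qed

lemma integrable_policy_stat:
  assumes "s \<in> space (states M)"
  shows "integrable (policy M P \<theta> s) (suff_stat P s)"
proof -
  have "integrable (policy M P \<theta> s) (\<lambda>a. \<Sum>b\<in>Basis. (suff_stat P s a \<bullet> b) *\<^sub>R b)"
    unfolding inner_commute[of "suff_stat P s _"]
    by (intro Bochner_Integration.integrable_sum integrable_scaleR_left
        integrable_policy_inner_stat[OF assms])
  then show ?thesis by (simp add: euclidean_representation)
qed

lemma inner_centered_stat:
  assumes "s \<in> space (states M)"
  shows "v \<bullet> centered_stat M P s a \<theta> =
    v \<bullet> suff_stat P s a - (\<integral>b. v \<bullet> suff_stat P s b \<partial>policy M P \<theta> s)"
  unfolding centered_stat_def
  by (simp add: inner_diff_right integral_inner_right[OF integrable_policy_stat[OF assms]])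

section \<open>State-action laws and the discounted state distribution\<close>

text \<open>By Tonelli, since the inner integral over the actions is 1 at every state.\<close>

lemma state_action_law_prob:
  assumes "D \<in> space (prob_algebra (states M))"
  shows "state_action_law M P D \<theta> \<in> space (prob_algebra (states M \<Otimes>\<^sub>M actions M))"
proof -
  have [measurable_cong]: "sets D = sets (states M)" and "prob_space D"
    using assms by (auto simp: space_prob_algebra)
  interpret prob_space D by fact
  have [simp]: "space D = space (states M)" by (rule sets_eq_imp_space_eq) fact
  have "emeasure (state_action_law M P D \<theta>) (space (D \<Otimes>\<^sub>M actions M)) =
    (\<integral>\<^sup>+ x. (case x of (s, a) \<Rightarrow> ennreal (policy_density M P \<theta> s a)) \<partial>(D \<Otimes>\<^sub>M actions M))"
    unfolding state_action_law_def
    by (subst emeasure_density) (auto intro!: nn_integral_cong)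
  also have "\<dots> = (\<integral>\<^sup>+ s. \<integral>\<^sup>+ a. ennreal (policy_density M P \<theta> s a) \<partial>actions M \<partial>D)"
    by (subst actions.nn_integral_fst[symmetric]) auto
  also have "\<dots> = (\<integral>\<^sup>+ s. 1 \<partial>D)"
  proof (intro nn_integral_cong)
    fix s assume "s \<in> space D"
    then have s: "s \<in> space (states M)" by simp
    note [measurable] = policy_density_measurable_section[OF s]
    have "(\<integral>\<^sup>+ a. ennreal (policy_density M P \<theta> s a) \<partial>actions M) =
      emeasure (policy M P \<theta> s) (space (policy M P \<theta> s))"
      unfolding policy_def by (subst emeasure_density) (auto intro!: nn_integral_cong)
    then show "(\<integral>\<^sup>+ a. ennreal (policy_density M P \<theta> s a) \<partial>actions M) = 1"
      using prob_space.emeasure_space_1[OF prob_space_policy[OF s]] by simp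
  qed
  also have "\<dots> = 1" using emeasure_space_1 by simp
  finally have "prob_space (state_action_law M P D \<theta>)"
    by (intro prob_spaceI) (simp add: state_action_law_def)
  then show ?thesis
    by (auto simp: space_prob_algebra state_action_law_def intro!: sets_pair_measure_cong \<open>sets D = _\<close>)
qed

lemma state_law_prob:
  assumes "\<omega> \<in> configs M"
  shows "state_law M P \<omega> \<theta> n \<in> space (prob_algebra (states M))"
proof (induction n)
  case 0
  then show ?case using mdp assms by (simp add: is_configurable_mdp_def)
next
  case (Suc n)
  have kernel: "transition M \<omega> \<in> states M \<Otimes>\<^sub>M actions M \<rightarrow>\<^sub>M prob_algebra (states M)"
    using mdp assms by (simp add: is_configurable_mdp_def)
  show ?case
    using prob_space_bind'[OF state_action_law_prob[OF Suc] kernel]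
      sets_bind'[OF state_action_law_prob[OF Suc] kernel]
    by (simp add: space_prob_algebra)
qed

lemma sets_discounted_state_dist: "sets (discounted_state_dist M P \<omega> \<theta>) = sets (states M)"
  unfolding discounted_state_dist_def by simp

text \<open>Every \<open>state_law\<close> has mass 1, so a convergent geometric series bounds the
  total mass. Finiteness is what Fubini's theorem below asks of \<open>D\<close>.\<close>

lemma finite_discounted_state_dist:
  assumes "\<omega> \<in> configs M"
  shows "finite_measure (discounted_state_dist M P \<omega> \<theta>)"
proof
  let ?D = "discounted_state_dist M P \<omega> \<theta>"
  have space: "space ?D = space (states M)"
    using sets_discounted_state_dist by (rule sets_eq_imp_space_eq)
  have one: "emeasure (state_law M P \<omega> \<theta> n) (space (states M)) = 1" for n
    using in_space_prob_algebra[OF state_law_prob[OF assms]] .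
  have \<gamma>: "0 \<le> discount M" "discount M < 1" using mdp by (auto simp: is_configurable_mdp_def)
  have "(\<Sum>n. ennreal (discount M ^ n)) \<noteq> \<infinity>"
    using summable_geometric[of "discount M"] \<gamma> by (subst suminf_ennreal2) auto
  moreover have "emeasure ?D (space ?D) \<le> ennreal (1 - discount M) * (\<Sum>n. ennreal (discount M ^ n))"
    unfolding space unfolding discounted_state_dist_def
    \<comment> \<open>an inequality, because \<open>measure_of\<close> is the zero measure where countable additivity fails\<close>
    by (subst emeasure_measure_of_conv) (auto simp: one)
  ultimately show "emeasure ?D (space ?D) \<noteq> \<infinity>"
    by (auto simp: ennreal_mult_eq_top_iff top_unique)
qed

text \<open>Fubini for \<open>D\<close> and the reference measure, after which the policy density is
  moved back into the inner measure.\<close>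

lemma integral_state_action_law:
  fixes f :: "'s \<times> 'a \<Rightarrow> real"
  assumes "finite_measure D" and [measurable_cong]: "sets D = sets (states M)"
    and int: "integrable (state_action_law M P D \<theta>) f"
  shows "(\<integral>x. f x \<partial>state_action_law M P D \<theta>) = (\<integral>s. \<integral>a. f (s, a) \<partial>policy M P \<theta> s \<partial>D)"
proof -
  interpret finite_measure D by fact
  interpret pair_sigma_finite D "actions M" ..
  have spaceD: "space D = space (states M)" using assms(2) by (rule sets_eq_imp_space_eq)
  let ?p = "\<lambda>x. policy_density M P \<theta> (fst x) (snd x)"
  have law: "state_action_law M P D \<theta> = density (D \<Otimes>\<^sub>M actions M) (\<lambda>x. ennreal (?p x))"
    by (simp only: state_action_law_def case_prod_beta')
  have [measurable]: "?p \<in> borel_measurable (D \<Otimes>\<^sub>M actions M)"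
    using policy_density_measurable[of \<theta>] by (simp add: case_prod_beta')
  have [measurable]: "f \<in> borel_measurable (D \<Otimes>\<^sub>M actions M)"
    using borel_measurable_integrable[OF int] unfolding law by simp
  have nonneg: "AE x in D \<Otimes>\<^sub>M actions M. 0 \<le> ?p x"
    by (intro AE_I2) (auto simp: space_pair_measure policy_density_nonneg)
  have "integrable (D \<Otimes>\<^sub>M actions M) (\<lambda>x. ?p x * f x)"
    using int unfolding law by (subst (asm) integrable_density[OF _ _ nonneg]) auto
  from integral_fst'[OF this]
  have "(\<integral>x. f x \<partial>state_action_law M P D \<theta>) =
    (\<integral>s. \<integral>a. policy_density M P \<theta> s a * f (s, a) \<partial>actions M \<partial>D)"
    unfolding law by (subst integral_density[OF _ _ nonneg]) auto
  also have "\<dots> = (\<integral>s. \<integral>a. f (s, a) \<partial>policy M P \<theta> s \<partial>D)"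
  proof (rule Bochner_Integration.integral_cong[OF refl])
    fix s assume s: "s \<in> space D"
    then have [measurable]: "policy_density M P \<theta> s \<in> borel_measurable (actions M)"
      using spaceD by simp
    have [measurable]: "(\<lambda>a. f (s, a)) \<in> borel_measurable (actions M)"
      using s by measurable
    show "(\<integral>a. policy_density M P \<theta> s a * f (s, a) \<partial>actions M) = (\<integral>a. f (s, a) \<partial>policy M P \<theta> s)"
      unfolding policy_def
      by (subst integral_density) (auto intro!: AE_I2 policy_density_nonneg)
  qed
  finally show ?thesis .
qed

section \<open>Derivatives of the negative log-likelihood along a line\<close>

text \<open>The factor \<open>base P a\<close> is common to all parameters, so only a term linear in
  \<open>x\<close> and the difference of log-partitions remain; the latter is the cumulant
  generating function of \<open>v \<bullet> suff_stat P s b\<close>.\<close>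

lemma neg_log_lik_line:
  assumes "s \<in> space (states M)" "a \<in> space (actions M)"
  shows "neg_log_lik M P (\<theta> + x *\<^sub>R v) (s, a) = neg_log_lik M P \<theta> (s, a)
    - x * (v \<bullet> suff_stat P s a) + ln (\<integral>b. exp (x * (v \<bullet> suff_stat P s b)) \<partial>policy M P \<theta> s)"
proof -
  have "ln (policy_density M P \<eta> s a) = ln (base P a) + \<eta> \<bullet> suff_stat P s a - log_partition M P \<eta> s"
    for \<eta>
    using base_pos[OF assms(2)] by (simp add: policy_density_def ln_mult)
  then show ?thesis
    using integral_policy_exp[OF assms(1), where v = "x *\<^sub>R v" and \<theta> = \<theta>]
    by (simp add: neg_log_lik_def inner_add_left)
qed

text \<open>Differentiability under the integral only asserts that some \<open>g\<close> and
  \<open>H\<close> exist. Uniqueness of derivatives identifies them along \<open>v\<close> with the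
  explicit first and second derivatives of the cumulant generating function.\<close>

lemma neg_log_lik_derivatives:
  fixes g :: "real^'d \<Rightarrow> real^'d"
  assumes s: "s \<in> space (states M)" and a: "a \<in> space (actions M)"
    and g: "\<And>w. GDERIV (\<lambda>w. neg_log_lik M P w (s, a)) w :> g w"
    and H: "(g has_derivative (\<lambda>h. H *v h)) (at \<theta>)"
  shows "v \<bullet> g \<theta> = - (v \<bullet> centered_stat M P s a \<theta>)"
    and "v \<bullet> (H *v v) = (\<integral>b. (v \<bullet> centered_stat M P s b \<theta>)\<^sup>2 \<partial>policy M P \<theta> s)"
proof -
  note [measurable] = stat_measurable_section[OF s]
  let ?X = "\<lambda>b. v \<bullet> suff_stat P s b"
  have int: "integrable (policy M P \<theta> s) (\<lambda>b. exp (x * ?X b))" for x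
    using integrable_policy_exp[OF s, where v = "x *\<^sub>R v" and \<theta> = \<theta>] by simp
  have [measurable]: "?X \<in> borel_measurable (policy M P \<theta> s)" by measurable
  obtain K where
    K: "\<And>x. ((\<lambda>x. ln (\<integral>b. exp (x * ?X b) \<partial>policy M P \<theta> s)) has_real_derivative K x) (at x)"
    and K0: "K 0 = (\<integral>b. ?X b \<partial>policy M P \<theta> s)"
    and K': "(K has_real_derivative
      (\<integral>b. (?X b - (\<integral>b. ?X b \<partial>policy M P \<theta> s))\<^sup>2 \<partial>policy M P \<theta> s)) (at 0)"
    by (rule cumulant_generating_function_derivs[OF prob_space_policy[OF s] _ int]) auto
  have line: "((\<lambda>x. \<theta> + x *\<^sub>R v) has_derivative (\<lambda>h. h *\<^sub>R v)) (at x)" for x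
    by (auto intro!: derivative_eq_intros)
  have vg: "v \<bullet> g (\<theta> + x *\<^sub>R v) = K x - ?X a" for x
  proof (rule DERIV_unique)
    show "((\<lambda>x. neg_log_lik M P (\<theta> + x *\<^sub>R v) (s, a)) has_real_derivative K x - ?X a) (at x)"
      unfolding neg_log_lik_line[OF s a] by (rule derivative_eq_intros K refl | simp)+
    show "((\<lambda>x. neg_log_lik M P (\<theta> + x *\<^sub>R v) (s, a)) has_real_derivative
        v \<bullet> g (\<theta> + x *\<^sub>R v)) (at x)"
      using has_derivative_compose[OF line g[unfolded gderiv_def]]
      by (simp add: has_field_derivative_def mult_commute_abs)
  qed
  show "v \<bullet> g \<theta> = - (v \<bullet> centered_stat M P s a \<theta>)"
    using vg[of 0] K0 by (simp add: inner_centered_stat[OF s])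
  have "((\<lambda>x. v \<bullet> g (\<theta> + x *\<^sub>R v)) has_real_derivative v \<bullet> (H *v v)) (at 0)"
    using has_derivative_inner_right[OF has_derivative_compose[OF line[of 0], of g "\<lambda>h. H *v h"], of v] H
    by (simp add: has_field_derivative_def mult_commute_abs matrix_vector_mult_scaleR inner_scaleR_right)
  \<comment> \<open>The term \<open>?X a\<close> is constant in \<open>x\<close>, so the second
    derivative does not depend on the action \<open>a\<close>.\<close>
  moreover have "((\<lambda>x. v \<bullet> g (\<theta> + x *\<^sub>R v)) has_real_derivative
      (\<integral>b. (?X b - (\<integral>b. ?X b \<partial>policy M P \<theta> s))\<^sup>2 \<partial>policy M P \<theta> s)) (at 0)"
    unfolding vg using DERIV_diff[OF K' DERIV_const[of "?X a"]] by simp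
  ultimately show "v \<bullet> (H *v v) = (\<integral>b. (v \<bullet> centered_stat M P s b \<theta>)\<^sup>2 \<partial>policy M P \<theta> s)"
    unfolding inner_centered_stat[OF s] by (rule DERIV_unique)
qed

end

section \<open>Taylor's formula and the Fisher information\<close>

lemma taylor_quadratic_lower_bound:
  fixes L L1 L2 :: "real \<Rightarrow> real"
  assumes "\<And>x. (L has_real_derivative L1 x) (at x)" "\<And>x. (L1 has_real_derivative L2 x) (at x)"
    and "L1 0 = 0" and "\<And>x. c \<le> L2 x"
  shows "c / 2 \<le> L 1 - L 0"
proof -
  \<comment> \<open>\<open>Taylor_up\<close> takes a sequence of derivatives; only the entries up to
    order 2 matter for the expansion.\<close>
  define diff where "diff m = (if m = 0 then L else if m = 1 then L1 else L2)" for m :: nat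
  have "\<exists>t>0. t < 1 \<and>
      L 1 = (\<Sum>m<2. (diff m 0 / fact m) * (1 - 0) ^ m) + (diff 2 t / fact 2) * (1 - 0) ^ 2"
    by (rule Taylor_up[where a = 0]) (auto simp: diff_def less_2_cases_iff assms)
  then obtain t where "L 1 = L 0 + L2 t / 2"
    by (auto simp: diff_def numeral_2_eq_2 assms)
  with assms(4)[of t] show ?thesis by simp
qed

text \<open>Two separate vectors \<open>x\<close> and \<open>y\<close> are kept so that the formula
  yields symmetry of the matrix, and nonnegativity of its form for \<open>x = y\<close>.\<close>

lemma fisher_information_form:
  assumes "integrable (state_action_law M P D \<theta>) (fisher_integrand M P \<theta>)"
  shows "x \<bullet> (fisher_information M P D \<theta> *v y) =
      (\<integral>(s, a). (x \<bullet> centered_stat M P s a \<theta>) * (y \<bullet> centered_stat M P s a \<theta>)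
        \<partial>state_action_law M P D \<theta>)"
    and "integrable (state_action_law M P D \<theta>)
      (\<lambda>(s, a). (x \<bullet> centered_stat M P s a \<theta>) * (y \<bullet> centered_stat M P s a \<theta>))"
proof -
  have "x \<bullet> (fisher_integrand M P \<theta> z *v y) =
    (case z of (s, a) \<Rightarrow> (x \<bullet> centered_stat M P s a \<theta>) * (y \<bullet> centered_stat M P s a \<theta>))" for z
    by (simp add: fisher_integrand_def outer_square_mult inner_commute split: prod.split)
  with inner_integral_matrix_vector[OF assms, of x y] show
    "x \<bullet> (fisher_information M P D \<theta> *v y) =
      (\<integral>(s, a). (x \<bullet> centered_stat M P s a \<theta>) * (y \<bullet> centered_stat M P s a \<theta>)
        \<partial>state_action_law M P D \<theta>)"
    "integrable (state_action_law M P D \<theta>)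
      (\<lambda>(s, a). (x \<bullet> centered_stat M P s a \<theta>) * (y \<bullet> centered_stat M P s a \<theta>))"
    by (simp_all add: fisher_information_def)
qed

text \<open>The forms are nonnegative, so the smallest eigenvalues are bounded below by 0 and
  \<open>INF\<close> is a true lower bound for them; the Rayleigh bound then applies at each
  parameter.\<close>

lemma lambda_min_le_rayleigh:
  assumes int: "\<And>\<theta>. integrable (state_action_law M P D \<theta>) (fisher_integrand M P \<theta>)"
  shows "lambda_min M P D * (norm v)\<^sup>2 \<le> v \<bullet> (fisher_information M P D \<theta> *v v)"
proof -
  let ?F = "fisher_information M P D"
  note form = fisher_information_form(1)[OF int]
  have sym: "x \<bullet> (?F \<theta> *v y) = y \<bullet> (?F \<theta> *v x)" for x y \<theta>
    unfolding form by (simp add: mult.commute)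
  have "0 \<le> x \<bullet> (?F \<theta> *v x)" for x \<theta>
    unfolding form by (intro integral_nonneg_AE) auto
  then have "0 \<le> min_eigenvalue (?F \<theta>)" for \<theta>
    by (intro min_eigenvalue_nonneg sym)
  then have "bdd_below (range (\<lambda>\<theta>. min_eigenvalue (?F \<theta>)))"
    by (intro bdd_belowI) auto
  then have "lambda_min M P D \<le> min_eigenvalue (?F \<theta>)"
    unfolding lambda_min_def by (rule cINF_lower) simp
  then have "lambda_min M P D * (norm v)\<^sup>2 \<le> min_eigenvalue (?F \<theta>) * (norm v)\<^sup>2"
    by (intro mult_right_mono) auto
  also have "\<dots> \<le> v \<bullet> (?F \<theta> *v v)"
    by (rule min_eigenvalue_le_rayleigh[OF sym])
  finally show ?thesis .
qed

section \<open>The likelihood gap between the restricted and the full gradient step\<close>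

theorem theorem5p1:
  fixes M :: "('s, 'a, 'p::finite) configurable_mdp"
    and P :: "('s, 'a, 'q::finite, 'd::finite) policy_family"
    and I :: "'d set"
    and \<theta>\<^sub>0 \<theta>\<^sub>I \<theta>\<^sub>s :: "real^'d"
    and \<alpha> :: real
    and \<omega> :: "real^'p"
    and D :: "'s measure"
  assumes "is_configurable_mdp M"
    and "is_linear_exponential_family M P"
    and "identifiable M P"
    and "differentiable_return M P"
    and "\<alpha> \<ge> 0"
    and "\<omega> \<in> configs M"
    and "\<theta>\<^sub>I = \<theta>\<^sub>0 + \<alpha> *\<^sub>R zero_on I (gradient (expected_return M P \<omega>) \<theta>\<^sub>0)"
    and "\<theta>\<^sub>s = \<theta>\<^sub>0 + \<alpha> *\<^sub>R gradient (expected_return M P \<omega>) \<theta>\<^sub>0"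
    and "D = discounted_state_dist M P \<omega> \<theta>\<^sub>s"
    and "\<And>\<theta>. integrable (state_action_law M P D \<theta>\<^sub>s) (neg_log_lik M P \<theta>)"
    and "twice_differentiable_under_integral (state_action_law M P D \<theta>\<^sub>s) (neg_log_lik M P)"
    and "\<And>\<theta>. integrable (state_action_law M P D \<theta>) (fisher_integrand M P \<theta>)"
    and "lambda_min M P D > 0"
  shows "expected_neg_log_lik M P \<omega> \<theta>\<^sub>s \<theta>\<^sub>I - expected_neg_log_lik M P \<omega> \<theta>\<^sub>s \<theta>\<^sub>s
    \<ge> lambda_min M P D * \<alpha>\<^sup>2 / 2 *
       (norm (zero_on (- I) (gradient (expected_return M P \<omega>) \<theta>\<^sub>0)))\<^sup>2"
proof -
  note mdp = assms(1,2) and fisher_int = assms(12)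
  \<comment> \<open>This is \<open>\<theta>\<^sub>I - \<theta>\<^sub>s\<close>: the restricted step
    lacks exactly the components in \<open>I\<close>, which are those kept by
    \<open>zero_on (- I)\<close>; hence also the sign.\<close>
  define v where "v = - \<alpha> *\<^sub>R zero_on (- I) (gradient (expected_return M P \<omega>) \<theta>\<^sub>0)"
  define N where "N = state_action_law M P D \<theta>\<^sub>s"
  have \<theta>\<^sub>I: "\<theta>\<^sub>I = \<theta>\<^sub>s + v"
    unfolding assms(7,8) v_def by (auto simp: vec_eq_iff zero_on_def)
  have setsD: "sets D = sets (states M)" and "finite_measure D"
    unfolding assms(9) using sets_discounted_state_dist[OF mdp] finite_discounted_state_dist[OF mdp assms(6)]
    by auto
  note fubini = integral_state_action_law[OF mdp \<open>finite_measure D\<close> setsD]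
  have spaceD: "space D = space (states M)" using setsD by (rule sets_eq_imp_space_eq)
  have spaceN: "space N = space (states M) \<times> space (actions M)"
    by (simp add: N_def state_action_law_def space_pair_measure spaceD)
  obtain g H where
    g: "\<And>\<theta> x. x \<in> space N \<Longrightarrow> GDERIV (\<lambda>w. neg_log_lik M P w x) \<theta> :> g \<theta> x"
    and H: "\<And>\<theta> x. x \<in> space N \<Longrightarrow> ((\<lambda>w. g w x) has_derivative (\<lambda>h. H \<theta> x *v h)) (at \<theta>)"
    and int: "\<And>\<theta>. integrable N (g \<theta>)" "\<And>\<theta>. integrable N (H \<theta>)"
    and Dg: "\<And>\<theta>. GDERIV (\<lambda>w. \<integral>x. neg_log_lik M P w x \<partial>N) \<theta> :> (\<integral>x. g \<theta> x \<partial>N)"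
    and DH: "\<And>\<theta>. ((\<lambda>w. \<integral>x. g w x \<partial>N) has_derivative (\<lambda>h. (\<integral>x. H \<theta> x \<partial>N) *v h)) (at \<theta>)"
    using assms(11) unfolding twice_differentiable_under_integral_def N_def[symmetric] by metis
  have vg: "v \<bullet> g \<theta> (s, a) = - (v \<bullet> centered_stat M P s a \<theta>)"
    and vH: "v \<bullet> (H \<theta> (s, a) *v v) = (\<integral>b. (v \<bullet> centered_stat M P s b \<theta>)\<^sup>2 \<partial>policy M P \<theta> s)"
    if "s \<in> space (states M)" "a \<in> space (actions M)" for s a \<theta>
    using neg_log_lik_derivatives[OF mdp that g H] that by (auto simp: spaceN)
  \<comment> \<open>At \<open>\<theta>\<^sub>s\<close> the actions come from the very policy that
    centres the statistic, so the inner expectation vanishes at each state.\<close>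
  have grad0: "v \<bullet> (\<integral>x. g \<theta>\<^sub>s x \<partial>N) = 0"
  proof -
    have "v \<bullet> (\<integral>x. g \<theta>\<^sub>s x \<partial>N) = (\<integral>x. v \<bullet> g \<theta>\<^sub>s x \<partial>N)"
      using int(1) by (simp add: integral_inner_right)
    also have "\<dots> = (\<integral>s. \<integral>a. v \<bullet> g \<theta>\<^sub>s (s, a) \<partial>policy M P \<theta>\<^sub>s s \<partial>D)"
      unfolding N_def using int(1)[of \<theta>\<^sub>s] by (intro fubini) (simp add: N_def)
    also have "\<dots> = (\<integral>s. 0 \<partial>D)"
    proof (rule Bochner_Integration.integral_cong[OF refl])
      fix s assume "s \<in> space D"
      then have s: "s \<in> space (states M)" using spaceD by simp
      interpret prob_space "policy M P \<theta>\<^sub>s s" by (rule prob_space_policy[OF mdp s])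
      have "(\<integral>a. v \<bullet> g \<theta>\<^sub>s (s, a) \<partial>policy M P \<theta>\<^sub>s s) =
        (\<integral>a. (\<integral>b. v \<bullet> suff_stat P s b \<partial>policy M P \<theta>\<^sub>s s) - v \<bullet> suff_stat P s a \<partial>policy M P \<theta>\<^sub>s s)"
        using s by (intro Bochner_Integration.integral_cong refl)
          (simp add: vg inner_centered_stat[OF mdp] policy_def)
      also have "\<dots> = 0"
        using integrable_policy_inner_stat[OF mdp s] by (simp add: prob_space)
      finally show "(\<integral>a. v \<bullet> g \<theta>\<^sub>s (s, a) \<partial>policy M P \<theta>\<^sub>s s) = 0" .
    qed
    finally show ?thesis by simp
  qed
  \<comment> \<open>The data draw actions from \<open>\<theta>\<^sub>s\<close>, the Fisher
    information from \<open>\<theta>\<close>. The Hessian form is constant in the action, so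
    averaging under \<open>\<theta>\<^sub>s\<close> leaves the variance under
    \<open>\<theta>\<close>, and both sides share the state distribution \<open>D\<close>.\<close>
  have hess: "v \<bullet> ((\<integral>x. H \<theta> x \<partial>N) *v v) = v \<bullet> (fisher_information M P D \<theta> *v v)" for \<theta>
  proof -
    have "v \<bullet> ((\<integral>x. H \<theta> x \<partial>N) *v v) = (\<integral>x. v \<bullet> (H \<theta> x *v v) \<partial>N)"
      by (rule inner_integral_matrix_vector(1)[OF int(2)])
    also have "\<dots> = (\<integral>s. \<integral>a. v \<bullet> (H \<theta> (s, a) *v v) \<partial>policy M P \<theta>\<^sub>s s \<partial>D)"
      unfolding N_def using inner_integral_matrix_vector(2)[OF int(2)] by (intro fubini) (simp add: N_def)
    also have "\<dots> = (\<integral>s. \<integral>b. (v \<bullet> centered_stat M P s b \<theta>)\<^sup>2 \<partial>policy M P \<theta> s \<partial>D)"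
    proof (rule Bochner_Integration.integral_cong[OF refl])
      fix s assume "s \<in> space D"
      then have s: "s \<in> space (states M)" using spaceD by simp
      interpret prob_space "policy M P \<theta>\<^sub>s s" by (rule prob_space_policy[OF mdp s])
      have "(\<integral>a. v \<bullet> (H \<theta> (s, a) *v v) \<partial>policy M P \<theta>\<^sub>s s) =
        (\<integral>a. (\<integral>b. (v \<bullet> centered_stat M P s b \<theta>)\<^sup>2 \<partial>policy M P \<theta> s) \<partial>policy M P \<theta>\<^sub>s s)"
        using s by (intro Bochner_Integration.integral_cong refl) (simp add: vH policy_def)
      then show "(\<integral>a. v \<bullet> (H \<theta> (s, a) *v v) \<partial>policy M P \<theta>\<^sub>s s) =
          (\<integral>b. (v \<bullet> centered_stat M P s b \<theta>)\<^sup>2 \<partial>policy M P \<theta> s)"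
        by (simp add: prob_space)
    qed
    also have "\<dots> = v \<bullet> (fisher_information M P D \<theta> *v v)"
      unfolding fisher_information_form(1)[OF fisher_int]
      by (subst fubini[OF fisher_information_form(2)[OF fisher_int]]) (simp add: power2_eq_square)
    finally show ?thesis .
  qed
  have line: "((\<lambda>x. \<theta>\<^sub>s + x *\<^sub>R v) has_derivative (\<lambda>h. h *\<^sub>R v)) (at x)" for x
    by (auto intro!: derivative_eq_intros)
  \<comment> \<open>The factors \<open>1\<close> and \<open>0\<close> are written out so that the
    difference has the form \<open>L 1 - L 0\<close>.\<close>
  have "lambda_min M P D * (norm v)\<^sup>2 / 2 \<le>
    (\<integral>y. neg_log_lik M P (\<theta>\<^sub>s + 1 *\<^sub>R v) y \<partial>N) - (\<integral>y. neg_log_lik M P (\<theta>\<^sub>s + 0 *\<^sub>R v) y \<partial>N)"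
  proof (rule taylor_quadratic_lower_bound)
    show "((\<lambda>x. \<integral>y. neg_log_lik M P (\<theta>\<^sub>s + x *\<^sub>R v) y \<partial>N) has_real_derivative
        v \<bullet> (\<integral>y. g (\<theta>\<^sub>s + x *\<^sub>R v) y \<partial>N)) (at x)" for x
      using has_derivative_compose[OF line Dg[unfolded gderiv_def]]
      by (simp add: has_field_derivative_def mult_commute_abs)
    show "((\<lambda>x. v \<bullet> (\<integral>y. g (\<theta>\<^sub>s + x *\<^sub>R v) y \<partial>N)) has_real_derivative
        v \<bullet> ((\<integral>y. H (\<theta>\<^sub>s + x *\<^sub>R v) y \<partial>N) *v v)) (at x)" for x
      using has_derivative_inner_right[OF has_derivative_compose[OF line DH], of v]
      by (simp add: has_field_derivative_def mult_commute_abs matrix_vector_mult_scaleR)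
    show "lambda_min M P D * (norm v)\<^sup>2 \<le> v \<bullet> ((\<integral>y. H (\<theta>\<^sub>s + x *\<^sub>R v) y \<partial>N) *v v)" for x
      unfolding hess using fisher_int by (rule lambda_min_le_rayleigh)
  qed (use grad0 in simp)
  then have "lambda_min M P D * (norm v)\<^sup>2 / 2 \<le>
    expected_neg_log_lik M P \<omega> \<theta>\<^sub>s \<theta>\<^sub>I - expected_neg_log_lik M P \<omega> \<theta>\<^sub>s \<theta>\<^sub>s"
    by (simp add: expected_neg_log_lik_def \<theta>\<^sub>I N_def assms(9)[symmetric])
  moreover have "(norm v)\<^sup>2 = \<alpha>\<^sup>2 * (norm (zero_on (- I) (gradient (expected_return M P \<omega>) \<theta>\<^sub>0)))\<^sup>2"
    by (simp add: v_def power_mult_distrib)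
  ultimately show ?thesis by simp
qed

end
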